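(* Let $G=(V,E)$ be a connected graph on $n$ nodes and let $r\ge1$ be an integer with $r\le\delta(G)$. (i) If $r=1$, then $\overleftarrow{MI}_r(G)=1$. (ii) If $r=2$, then $2\le \overleftarrow{MI}_r(G)\le \frac{n}{1+x}$, where $x=0$ if $n$ is odd and $x=1$ if $n$ is even. (iii) If $r\ge3$, then $r\le \overleftarrow{MI}_r(G)\le n$.
   Context: $\delta(G)$ is the minimum degree of $G$. A configuration is a map $\mathcal{C}:V\to\{b,w\}$ (black/white). In two-way $r$-bootstrap percolation, starting from $\mathcal{C}_0$, in each round $t\ge1$ all nodes update simultaneously: $\mathcal{C}_t(v)=b$ if $v$ has at least $r$ neighbors that are black in $\mathcal{C}_{t-1}$, and $\mathcal{C}_t(v)=w$ otherwise. A set $I\subseteq V$ is an immortal set if for every initial configuration in which all nodes of $I$ are black, in every round $t'\ge0$ at least one node of $V$ is black. $\overleftarrow{MI}_r(G)$ denotes the minimum size of an immortal set in two-way $r$-bootstrap percolation on $G$. Standing assumptions: $r\le\delta(G)$, and $r$ is fixed while $n\to\infty$. *)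

theory Defs
  imports Complex_Main "Graph_Theory.Digraph_Component"
begin

text \<open>
  A finite simple undirected graph is a digraph satisfying the locale predicate \<open>graph\<close>
  (finite, loop-free, no parallel arcs, symmetric): an edge \<open>{u, v}\<close> is represented by the two
  opposite arcs between \<open>u\<close> and \<open>v\<close>, so that the degree of a vertex is its out-degree.
\<close>

definition min_degree :: "('a, 'b) pre_digraph \<Rightarrow> nat" where
  "min_degree G = Min (out_degree G ` verts G)"

definition neighbors :: "('a, 'b) pre_digraph \<Rightarrow> 'a \<Rightarrow> 'a set" where
  "neighbors G v = {u. v \<rightarrow>\<^bsub>G\<^esub> u}"

text \<open>
  Configurations are total functions on the vertex type. Colours outside \<open>verts G\<close> are
  irrelevant, since all neighbours lie in \<open>verts G\<close>.
\<close>

datatype colour = Black | White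

type_synonym 'a config = "'a \<Rightarrow> colour"

definition two_way_step :: "nat \<Rightarrow> ('a, 'b) pre_digraph \<Rightarrow> 'a config \<Rightarrow> 'a config" where
  "two_way_step r G C v =
     (if r \<le> card {u \<in> neighbors G v. C u = Black} then Black else White)"

definition two_way_config :: "nat \<Rightarrow> ('a, 'b) pre_digraph \<Rightarrow> 'a config \<Rightarrow> nat \<Rightarrow> 'a config" where
  "two_way_config r G C t = (two_way_step r G ^^ t) C"

definition immortal_set :: "nat \<Rightarrow> ('a, 'b) pre_digraph \<Rightarrow> 'a set \<Rightarrow> bool" where
  "immortal_set r G I \<longleftrightarrow> I \<subseteq> verts G \<and>
     (\<forall>C. (\<forall>v\<in>I. C v = Black) \<longrightarrow> (\<forall>t. \<exists>v\<in>verts G. two_way_config r G C t v = Black))"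

text \<open>
  If \<open>1 \<le> r \<le> min_degree G\<close> and \<open>G\<close> is a nonempty finite graph, then \<open>verts G\<close> itself is
  immortal, so the minimum is taken over a nonempty finite set.
\<close>

definition MI :: "nat \<Rightarrow> ('a, 'b) pre_digraph \<Rightarrow> nat" where
  "MI r G = Min (card ` {I. immortal_set r G I})"

end

theory Submission
  imports Defs "Graph_Theory.Vertex_Walk"
begin

text \<open>
  Fewer than \<open>r\<close> black vertices die in one round. Conversely, if every vertex of \<open>S\<close> has \<open>r\<close>
  neighbours in \<open>T\<close> and vice versa, then \<open>S\<close> is immortal. For \<open>r = 2\<close>, let \<open>S\<close> and \<open>T\<close> consist of
  the vertices reached after even and odd numbers of steps around a cycle: these are the two halves
  of an even cycle, and both the whole of an odd one. So for even \<open>n\<close> it suffices to find an even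
  cycle or one of length at most \<open>n / 2\<close>.

  Take a longest path \<open>p\<^sub>0, \<dots>, p\<^sub>k\<close>; its ends have chords to \<open>p\<^sub>i\<close> and \<open>p\<^sub>j\<close> respectively, where
  \<open>2 \<le> i\<close> and \<open>j \<le> k - 2\<close>. If \<open>i \<le> j\<close>, the two resulting cycles share at most one vertex, so one has
  length at most \<open>(n + 1) / 2\<close>. If \<open>j < i\<close> and both are odd, the cycle
  \<open>p\<^sub>0, \<dots>, p\<^sub>j, p\<^sub>k, \<dots>, p\<^sub>i\<close> is even, unless both chords are the edge \<open>p\<^sub>0 p\<^sub>k\<close>; then the
  longest path closes up to a cycle, which must span the connected graph and has length \<open>n\<close>.
\<close>

section \<open>Neighbourhoods\<close>

lemma (in wf_digraph) neighbors_subset_verts: "neighbors G v \<subseteq> verts G"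
  by (auto simp: neighbors_def adj_in_verts)

lemma (in fin_digraph) finite_neighbors: "finite (neighbors G v)"
  using finite_subset[OF neighbors_subset_verts finite_verts] .

lemma (in nomulti_digraph) card_neighbors: "card (neighbors G v) = out_degree G v"
proof -
  have "inj_on (head G) (out_arcs G v)"
    by (auto intro!: inj_onI no_multi_arcs simp: arc_to_ends_def)
  moreover have "neighbors G v = head G ` out_arcs G v"
    by (auto simp: neighbors_def arcs_ends_def arc_to_ends_def)
  ultimately show ?thesis
    by (simp add: out_degree_def card_image)
qed

lemma (in digraph) min_degree_le_card_neighbors:
  "v \<in> verts G \<Longrightarrow> min_degree G \<le> card (neighbors G v)"
  by (simp add: card_neighbors min_degree_def)

lemma (in wf_digraph) strongly_connected_closed_eq_verts:
  assumes "strongly_connected G" "S \<subseteq> verts G" "S \<noteq> {}"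
    and closed: "\<And>u v. u \<in> S \<Longrightarrow> u \<rightarrow> v \<Longrightarrow> v \<in> S"
  shows "S = verts G"
proof -
  obtain u where "u \<in> S" using \<open>S \<noteq> {}\<close> by blast
  have "w \<in> S" if "w \<in> verts G" for w
  proof -
    have "u \<rightarrow>\<^sup>* w"
      using assms(1,2) \<open>u \<in> S\<close> that by (auto simp: strongly_connected_def)
    then show ?thesis
      using \<open>u \<in> S\<close> closed by (induction rule: reachable_induct) auto
  qed
  then show ?thesis using \<open>S \<subseteq> verts G\<close> by blast
qed

section \<open>Immortal sets\<close>

definition sustains :: "nat \<Rightarrow> ('a, 'b) pre_digraph \<Rightarrow> 'a set \<Rightarrow> 'a set \<Rightarrow> bool" where
  "sustains r G S T \<longleftrightarrow> (\<forall>v\<in>T. r \<le> card (neighbors G v \<inter> S))"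

lemma (in fin_digraph) two_way_step_eq_Black_if_sustains:
  assumes "sustains r G S T" "\<forall>u\<in>S. C u = Black" "v \<in> T"
  shows "two_way_step r G C v = Black"
proof -
  have "r \<le> card (neighbors G v \<inter> S)"
    using assms by (simp add: sustains_def)
  also have "\<dots> \<le> card {u \<in> neighbors G v. C u = Black}"
    using assms finite_neighbors by (intro card_mono) auto
  finally show ?thesis by (simp add: two_way_step_def)
qed

lemma (in fin_digraph) immortal_set_if_sustains:
  assumes "S \<subseteq> verts G" "T \<subseteq> verts G" "S \<noteq> {}" "T \<noteq> {}"
    and "sustains r G S T" "sustains r G T S"
  shows "immortal_set r G S"
proof -
  have "\<forall>v \<in> (if even t then S else T). two_way_config r G C t v = Black"
    if "\<forall>v\<in>S. C v = Black" for C t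
  proof (induction t)
    case 0
    then show ?case using that by (simp add: two_way_config_def)
  next
    case (Suc t)
    then show ?case
      using two_way_step_eq_Black_if_sustains[OF assms(5)]
        two_way_step_eq_Black_if_sustains[OF assms(6)]
      by (simp add: two_way_config_def split: if_splits)
  qed
  moreover have "\<exists>v\<in>verts G. v \<in> (if even t then S else T)" for t :: nat
    using assms(1-4) by auto
  ultimately show ?thesis
    unfolding immortal_set_def using \<open>S \<subseteq> verts G\<close> by meson
qed

lemma (in digraph) immortal_set_verts:
  assumes "verts G \<noteq> {}" "r \<le> min_degree G"
  shows "immortal_set r G (verts G)"
proof -
  have "sustains r G (verts G) (verts G)"
    unfolding sustains_def
    using assms(2) min_degree_le_card_neighbors neighbors_subset_verts
    by (metis inf.absorb1 le_trans)
  then show ?thesis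
    using assms(1) by (intro immortal_set_if_sustains) auto
qed

lemma (in fin_digraph) le_card_immortal_set:
  assumes immortal: "immortal_set r G I"
  shows "r \<le> card I"
proof (rule ccontr)
  assume few: "\<not> r \<le> card I"
  define C where "C v = (if v \<in> I then Black else White)" for v
  have "finite I"
    using immortal finite_subset[OF _ finite_verts] by (auto simp: immortal_set_def)
  have "two_way_step r G C v = White" for v
  proof -
    have "card {u \<in> neighbors G v. C u = Black} \<le> card I"
      using \<open>finite I\<close> by (rule card_mono) (auto simp: C_def split: if_splits)
    then show ?thesis using few by (simp add: two_way_step_def)
  qed
  then have "\<forall>v. two_way_config r G C 1 v \<noteq> Black" by (simp add: two_way_config_def)
  moreover have "\<forall>v\<in>I. C v = Black" by (simp add: C_def)
  ultimately show False using immortal unfolding immortal_set_def by blast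
qed

lemma (in fin_digraph) finite_immortal_sets: "finite {I. immortal_set r G I}"
  by (rule finite_subset[of _ "Pow (verts G)"]) (auto simp: immortal_set_def)

lemma (in fin_digraph) MI_le_card: "immortal_set r G I \<Longrightarrow> MI r G \<le> card I"
  by (simp add: MI_def finite_immortal_sets)

lemma (in fin_digraph) le_MI:
  assumes "immortal_set r G I"
  shows "r \<le> MI r G"
proof -
  have "card ` {I. immortal_set r G I} \<noteq> {}" using assms by blast
  then show ?thesis
    unfolding MI_def using finite_immortal_sets le_card_immortal_set by (subst Min_ge_iff) auto
qed

lemma (in pseudo_graph) MI_1_eq_1:
  assumes "u \<rightarrow> v"
  shows "MI 1 G = 1"
proof -
  have "v \<rightarrow> u" using assms by (rule arcs_ends_symmetric[OF sym_arcs])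
  have "immortal_set 1 G {u}"
  proof (rule immortal_set_if_sustains[of _ "{v}"])
    show "sustains 1 G {u} {v}" "sustains 1 G {v} {u}"
      using assms \<open>v \<rightarrow> u\<close> by (simp_all add: sustains_def neighbors_def)
  qed (use assms adj_in_verts in auto)
  then show ?thesis using MI_le_card[of 1 "{u}"] le_MI[of 1 "{u}"] by simp
qed

section \<open>Paths and cycles\<close>

lemma vwalk_append_iff:
  assumes "p \<noteq> []" "q \<noteq> []"
  shows "vwalk (p @ q) G \<longleftrightarrow> vwalk p G \<and> vwalk q G \<and> last p \<rightarrow>\<^bsub>G\<^esub> hd q"
  using assms by (auto simp: vwalk_def vwalk_arcs_append)

lemma vpath_append_iff:
  assumes "p \<noteq> []" "q \<noteq> []"
  shows "vpath (p @ q) G \<longleftrightarrow>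
    vpath p G \<and> vpath q G \<and> last p \<rightarrow>\<^bsub>G\<^esub> hd q \<and> set p \<inter> set q = {}"
  using vwalk_append_iff[OF assms] by (auto simp: vpath_def)

lemma vpathD:
  assumes "vpath p G"
  shows "p \<noteq> []" "distinct p" "set p \<subseteq> verts G"
  using assms by (simp_all add: vpath_def vwalk_def)

lemma vpath_take: "vpath p G \<Longrightarrow> 0 < i \<Longrightarrow> vpath (take i p) G"
  by (metis append_take_drop_id distinct_take take_eq_Nil2 vpath_def vwalkI_append_l vwalk_def
      less_not_refl)

lemma vpath_drop: "vpath p G \<Longrightarrow> i < length p \<Longrightarrow> vpath (drop i p) G"
  by (metis append_take_drop_id distinct_drop drop_eq_Nil2 linorder_not_le vpath_def
      vwalkI_append_r)

lemma (in sym_digraph) vpath_rev: "vpath p G \<Longrightarrow> vpath (rev p) G"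
  using arcs_ends_symmetric[OF sym_arcs] by (auto simp: vpath_def vwalk_def set_vwalk_arcs_rev)

lemma (in fin_digraph) length_vpath_le: "vpath p G \<Longrightarrow> length p \<le> card (verts G)"
  using card_mono[OF finite_verts vpathD(3)] by (simp add: vpathD(2) distinct_card)

definition vcycle :: "'a vwalk \<Rightarrow> ('a, 'b) pre_digraph \<Rightarrow> bool" where
  "vcycle p G \<longleftrightarrow> vpath p G \<and> 3 \<le> length p \<and> last p \<rightarrow>\<^bsub>G\<^esub> hd p"

lemma vcycle_rotate:
  assumes "vcycle p G"
  shows "vcycle (rotate i p) G"
proof (induction i)
  case 0
  then show ?case using assms by simp
next
  case (Suc i)
  then obtain x y q where rotate_i: "rotate i p = x # y # q"
    by (cases "rotate i p" rule: remdups_adj.cases) (auto simp: vcycle_def)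
  then have "vcycle ((y # q) @ [x]) G"
    using Suc vpath_append_iff[of "[x]" "y # q" G] vpath_append_iff[of "y # q" "[x]" G]
    by (auto simp: vcycle_def)
  then show ?case using rotate_i by simp
qed

lemma vcycle_nth_mod_dominates:
  assumes "vcycle p G"
  shows "p ! (i mod length p) \<rightarrow>\<^bsub>G\<^esub> p ! (Suc i mod length p)"
proof -
  obtain x y q where rotate_i: "rotate i p = x # y # q"
    using vcycle_rotate[OF assms, of i]
    by (cases "rotate i p" rule: remdups_adj.cases) (auto simp: vcycle_def)
  have "p \<noteq> []" "1 < length p" using assms by (auto simp: vcycle_def)
  then have "x = p ! (i mod length p)" "y = p ! (Suc i mod length p)"
    using nth_rotate[of 0 p i] nth_rotate[of 1 p i] rotate_i by simp_all
  moreover have "x \<rightarrow>\<^bsub>G\<^esub> y"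
    using vcycle_rotate[OF assms, of i] rotate_i by (simp add: vcycle_def vpath_def vwalk_def)
  ultimately show ?thesis by simp
qed

lemma vcycle_nth_mod_neq:
  assumes "vcycle p G"
  shows "p ! (i mod length p) \<noteq> p ! ((i + 2) mod length p)"
proof -
  have "3 \<le> length p" "p \<noteq> []" "distinct p"
    using assms by (auto simp: vcycle_def dest: vpathD)
  have "i mod length p \<noteq> (i + 2) mod length p"
  proof
    assume "i mod length p = (i + 2) mod length p"
    then have "length p dvd 2" using mod_eq_dvd_iff_nat[of i "i + 2" "length p"] by simp
    then show False using \<open>3 \<le> length p\<close> by (auto dest: dvd_imp_le)
  qed
  then show ?thesis
    using \<open>p \<noteq> []\<close> \<open>distinct p\<close> by (subst nth_eq_iff_index_eq) auto
qed

lemma (in pseudo_graph) two_le_card_neighbors_Int_if_vcycle: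
  assumes cycle: "vcycle p G"
    and ends_in_A: "p ! (i mod length p) \<in> A" "p ! ((i + 2) mod length p) \<in> A"
  shows "2 \<le> card (neighbors G (p ! (Suc i mod length p)) \<inter> A)"
proof -
  let ?a = "p ! (i mod length p)" and ?b = "p ! ((i + 2) mod length p)"
  let ?N = "neighbors G (p ! (Suc i mod length p))"
  have "?a \<in> ?N" "?b \<in> ?N"
    using vcycle_nth_mod_dominates[OF cycle, of i] vcycle_nth_mod_dominates[OF cycle, of "Suc i"]
      arcs_ends_symmetric[OF sym_arcs] by (simp_all add: neighbors_def)
  then have "card {?a, ?b} \<le> card (?N \<inter> A)"
    using ends_in_A finite_neighbors by (intro card_mono) auto
  then show ?thesis using vcycle_nth_mod_neq[OF cycle] by simp
qed

text \<open>For odd length the steps of two wrap around and reach every vertex.\<close>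

definition alternate_vertices :: "'a vwalk \<Rightarrow> 'a set" where
  "alternate_vertices p = range (\<lambda>i. p ! (2 * i mod length p))"

lemma alternate_vertices_subset: "p \<noteq> [] \<Longrightarrow> alternate_vertices p \<subseteq> set p"
  by (auto simp: alternate_vertices_def)

lemma card_alternate_vertices_le: "p \<noteq> [] \<Longrightarrow> card (alternate_vertices p) \<le> length p"
  using card_mono[OF _ alternate_vertices_subset[of p]] card_length[of p] by simp

lemma card_alternate_vertices_le_half:
  assumes "p \<noteq> []" "even (length p)"
  shows "2 * card (alternate_vertices p) \<le> length p"
proof -
  obtain h where length_p: "length p = 2 * h" using \<open>even (length p)\<close> by blast
  then have "0 < h" using \<open>p \<noteq> []\<close> by (simp flip: length_greater_0_conv)
  have "alternate_vertices p = range (\<lambda>i. p ! (2 * (i mod h)))"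
    using length_p by (simp add: alternate_vertices_def)
  also have "\<dots> \<subseteq> (\<lambda>i. p ! (2 * i)) ` {..<h}"
    using \<open>0 < h\<close> by (auto intro!: imageI)
  finally have "card (alternate_vertices p) \<le> card {..<h}"
    by (meson card_image_le card_mono finite_imageI finite_lessThan le_trans)
  then show ?thesis using length_p by simp
qed

lemma (in pseudo_graph) immortal_set_alternate_vertices:
  assumes cycle: "vcycle p G"
  shows "immortal_set 2 G (alternate_vertices p)"
proof -
  define c where "c i = p ! (i mod length p)" for i
  have "p \<noteq> []" using cycle by (auto simp: vcycle_def)
  have c_in_verts: "c i \<in> verts G" for i
    using cycle vpathD(3)[of p G] \<open>p \<noteq> []\<close> by (auto simp: c_def vcycle_def)
  have two_neighbors: "2 \<le> card (neighbors G (c (Suc i)) \<inter> A)" if "c i \<in> A" "c (i + 2) \<in> A" for i A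
    using two_le_card_neighbors_Int_if_vcycle[OF cycle] that by (simp add: c_def)
  let ?S = "range (\<lambda>i. c (2 * i))" and ?T = "range (\<lambda>i. c (Suc (2 * i)))"
  have "sustains 2 G ?S ?T"
  proof -
    have "c (2 * i) \<in> ?S" "c (2 * i + 2) \<in> ?S" for i
      using rangeI[of "\<lambda>i. c (2 * i)" "Suc i"] by auto
    then show ?thesis using two_neighbors by (auto simp: sustains_def)
  qed
  moreover have "sustains 2 G ?T ?S"
    unfolding sustains_def
  proof safe
    fix i
    define k where "k = i + (length p - 1)"
    have "c (Suc (2 * k)) \<in> ?T" "c (Suc (2 * k) + 2) \<in> ?T"
      using rangeI[of "\<lambda>i. c (Suc (2 * i))" "Suc k"] by auto
    then have "2 \<le> card (neighbors G (c (Suc (Suc (2 * k)))) \<inter> ?T)"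
      by (rule two_neighbors)
    moreover have "Suc (Suc (2 * k)) = 2 * i + 2 * length p"
      using \<open>p \<noteq> []\<close> by (cases p) (simp_all add: k_def)
    ultimately show "2 \<le> card (neighbors G (c (2 * i)) \<inter> ?T)"
      by (simp add: c_def)
  qed
  ultimately have "immortal_set 2 G ?S"
    using c_in_verts by (intro immortal_set_if_sustains[of _ ?T]) auto
  then show ?thesis by (simp add: alternate_vertices_def c_def)
qed

section \<open>Longest paths\<close>

definition longest_vpath :: "'a vwalk \<Rightarrow> ('a, 'b) pre_digraph \<Rightarrow> bool" where
  "longest_vpath p G \<longleftrightarrow> vpath p G \<and> (\<forall>q. vpath q G \<longrightarrow> length q \<le> length p)"

lemma (in fin_digraph) ex_longest_vpath:
  assumes "verts G \<noteq> {}"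
  obtains p where "longest_vpath p G"
proof -
  obtain v where "v \<in> verts G" using assms by blast
  then have "vpath [v] G" by (rule vpath_self)
  moreover have "\<forall>q. vpath q G \<longrightarrow> length q < Suc (card (verts G))"
    using length_vpath_le by (simp add: less_Suc_eq_le)
  ultimately have "\<exists>p. longest_vpath p G"
    unfolding longest_vpath_def by (rule Lattices_Big.ex_has_greatest_nat)
  then show ?thesis using that by blast
qed

lemma (in sym_digraph) longest_vpath_rev: "longest_vpath p G \<Longrightarrow> longest_vpath (rev p) G"
  using vpath_rev by (simp add: longest_vpath_def)

lemma (in wf_digraph) longest_vpath_last_dominates:
  assumes "longest_vpath p G" "last p \<rightarrow> v"
  shows "v \<in> set p"
proof (rule ccontr)
  assume "v \<notin> set p"
  have "vpath p G" "p \<noteq> []"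
    using assms(1) by (auto simp: longest_vpath_def dest: vpathD)
  then have "vpath (p @ [v]) G"
    using assms(2) \<open>v \<notin> set p\<close> vpath_self[OF adj_in_verts(2)] by (simp add: vpath_append_iff)
  then have "length (p @ [v]) \<le> length p" using assms(1) unfolding longest_vpath_def by blast
  then show False by simp
qed

lemma (in loopfree_digraph) longest_vpath_last_chord:
  assumes longest: "longest_vpath p G" and deg: "2 \<le> card (neighbors G (last p))"
  obtains j where "j + 2 < length p" "last p \<rightarrow> p ! j"
proof -
  have "p \<noteq> []" using longest by (auto simp: longest_vpath_def dest: vpathD)
  have "\<not> neighbors G (last p) \<subseteq> {p ! (length p - 2)}"
    using deg card_mono[of "{p ! (length p - 2)}" "neighbors G (last p)"] by auto
  then obtain u where neighbor_u: "last p \<rightarrow> u" "u \<noteq> p ! (length p - 2)"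
    by (auto simp: neighbors_def)
  then obtain j where nth_j: "j < length p" "u = p ! j"
    using longest_vpath_last_dominates[OF longest] by (metis in_set_conv_nth)
  have "u \<noteq> p ! (length p - 1)"
    using neighbor_u(1) adj_not_same \<open>p \<noteq> []\<close> by (auto simp: last_conv_nth)
  then have "j \<noteq> length p - 1" "j \<noteq> length p - 2" using neighbor_u(2) nth_j(2) by auto
  then have "j + 2 < length p" using nth_j(1) by linarith
  then show ?thesis using that neighbor_u(1) nth_j(2) by blast
qed

lemma (in wf_digraph) longest_vpath_vcycle_spanning:
  assumes "strongly_connected G" and longest: "longest_vpath p G" and cycle: "vcycle p G"
  shows "set p = verts G"
proof (rule strongly_connected_closed_eq_verts[OF assms(1)])
  show "set p \<subseteq> verts G" "set p \<noteq> {}"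
    using cycle vpathD[of p G] by (auto simp: vcycle_def)
next
  fix u v assume "u \<in> set p" "u \<rightarrow> v"
  obtain as bs where split: "p = as @ u # bs" using \<open>u \<in> set p\<close> by (auto dest: split_list)
  define q where "q = rotate (length (as @ [u])) p"
  have q_eq: "q = bs @ as @ [u]"
    unfolding q_def split using rotate_append[of "as @ [u]" bs] by simp
  have "vpath q G"
    using vcycle_rotate[OF cycle, of "length (as @ [u])"] by (simp only: q_def vcycle_def)
  then have "longest_vpath q G"
    using longest by (simp add: longest_vpath_def q_def)
  then have "v \<in> set q"
    by (rule longest_vpath_last_dominates) (simp add: q_eq \<open>u \<rightarrow> v\<close>)
  then show "v \<in> set p" by (simp add: q_def)
qed

section \<open>Even or short cycles\<close>

lemma vcycle_drop:
  assumes "vpath p G" "j + 2 < length p" "last p \<rightarrow>\<^bsub>G\<^esub> p ! j"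
  shows "vcycle (drop j p) G"
  using assms vpath_drop[of p G j] by (simp add: vcycle_def hd_drop_conv_nth)

lemma (in sym_digraph) vcycle_take:
  assumes "vpath p G" "2 \<le> i" "i < length p" "hd p \<rightarrow> p ! i"
  shows "vcycle (take (Suc i) p) G"
proof -
  have "p ! i \<rightarrow> hd p" using assms(4) by (rule arcs_ends_symmetric[OF sym_arcs])
  then show ?thesis
    using assms vpath_take[of p G "Suc i"] by (auto simp: vcycle_def take_Suc_conv_app_nth hd_append)
qed

lemma (in sym_digraph) vcycle_crossing_chords:
  assumes path: "vpath p G" and "j < i" "i < length p" and ends: "j \<noteq> 0 \<or> i \<noteq> length p - 1"
    and chords: "last p \<rightarrow> p ! j" "hd p \<rightarrow> p ! i"
  shows "vcycle (take (Suc j) p @ rev (drop i p)) G"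
proof -
  let ?q = "take (Suc j) p" and ?s = "rev (drop i p)"
  have ne: "?q \<noteq> []" "?s \<noteq> []" "p \<noteq> []" using assms(2,3) by auto
  have "last ?q = p ! j" "hd ?q = hd p"
    using assms(2,3) ne by (auto simp: last_conv_nth hd_conv_nth min_def)
  have "hd ?s = last p" "last ?s = p ! i"
    using assms(3) by (simp_all add: hd_rev last_rev hd_drop_conv_nth)
  have "p ! j \<rightarrow> last p" "p ! i \<rightarrow> hd p"
    using chords arcs_ends_symmetric[OF sym_arcs] by blast+
  have "set ?q \<inter> set ?s = {}"
    using path \<open>j < i\<close> set_take_disj_set_drop_if_distinct[of p "Suc j" i] by (auto simp: vpath_def)
  moreover have "vpath ?q G" "vpath ?s G"
    using path \<open>i < length p\<close> by (auto intro: vpath_take vpath_drop vpath_rev)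
  ultimately have "vpath (?q @ ?s) G"
    using ne \<open>last ?q = p ! j\<close> \<open>hd ?s = last p\<close> \<open>p ! j \<rightarrow> last p\<close> by (simp add: vpath_append_iff)
  moreover have "3 \<le> length (?q @ ?s)"
    using assms(2,3) ends by auto
  ultimately show ?thesis
    using ne \<open>hd ?q = hd p\<close> \<open>last ?s = p ! i\<close> \<open>p ! i \<rightarrow> hd p\<close> by (simp add: vcycle_def)
qed

lemma (in sym_digraph) vcycle_if_end_chords:
  assumes path: "vpath p G"
    and hd_chord: "2 \<le> i" "i < length p" "hd p \<rightarrow> p ! i"
    and last_chord: "j + 2 < length p" "last p \<rightarrow> p ! j"
  obtains c where "vcycle c G" "even (length c) \<or> c = p \<or> 2 * length c \<le> length p + 1"
proof -
  have first_cycle: "vcycle (take (Suc i) p) G"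
    using path hd_chord by (rule vcycle_take)
  have last_cycle: "vcycle (drop j p) G"
    using path last_chord by (rule vcycle_drop)
  consider (even_cycle) "odd i \<or> even (length p - j)" | (disjoint_chords) "i \<le> j"
    | (closed_path) "j = 0" "i = length p - 1"
    | (crossing_chords) "even i" "odd (length p - j)" "j < i" "j \<noteq> 0 \<or> i \<noteq> length p - 1"
    by linarith
  then show thesis
  proof cases
    case even_cycle
    then show thesis using that[OF first_cycle] that[OF last_cycle] hd_chord(2) by auto
  next
    case disjoint_chords
    then have "2 * Suc i \<le> length p + 1 \<or> 2 * (length p - j) \<le> length p + 1"
      using last_chord(1) by arith
    then show thesis using that[OF first_cycle] that[OF last_cycle] hd_chord(2) by auto
  next
    case closed_path
    then show thesis using that[OF last_cycle] by simp
  next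
    case crossing_chords
    have "even (length (take (Suc j) p @ rev (drop i p)))"
      using crossing_chords(1,2) hd_chord(2) last_chord(1) by auto
    then show thesis
      using that vcycle_crossing_chords[OF path crossing_chords(3) hd_chord(2)]
        crossing_chords(4) last_chord(2) hd_chord(3) by blast
  qed
qed

lemma (in graph) longest_vpath_end_chords:
  assumes longest: "longest_vpath p G" and deg: "2 \<le> min_degree G"
  obtains i j where "2 \<le> i" "i < length p" "hd p \<rightarrow> p ! i" "j + 2 < length p" "last p \<rightarrow> p ! j"
proof -
  have two_neighbors: "2 \<le> card (neighbors G (last q))" if "longest_vpath q G" for q
  proof -
    have "last q \<in> verts G"
      using that vpathD[of q G] last_in_set by (auto simp: longest_vpath_def)
    then show ?thesis using min_degree_le_card_neighbors deg by (meson le_trans)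
  qed
  obtain j where last_chord: "j + 2 < length p" "last p \<rightarrow> p ! j"
    using longest_vpath_last_chord[OF longest two_neighbors[OF longest]] .
  have longest_rev: "longest_vpath (rev p) G" using longest by (rule longest_vpath_rev)
  obtain k where rev_chord: "k + 2 < length p" "last (rev p) \<rightarrow> rev p ! k"
    using longest_vpath_last_chord[OF longest_rev two_neighbors[OF longest_rev]] by auto
  then have "hd p \<rightarrow> p ! (length p - Suc k)"
    by (auto simp: rev_nth last_rev)
  then show thesis using that[of "length p - Suc k" j] last_chord rev_chord(1) by simp
qed

lemma (in graph) ex_even_or_spanning_or_short_vcycle:
  assumes conn: "Digraph_Component.connected G" and deg: "2 \<le> min_degree G"
  obtains c where "vcycle c G"
    "even (length c) \<or> length c = card (verts G) \<or> 2 * length c \<le> card (verts G) + 1"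
proof -
  have sconn: "strongly_connected G"
    using sym_arcs conn by (rule symmetric_connected_imp_strongly_connected)
  then obtain p where longest: "longest_vpath p G"
    using ex_longest_vpath by (auto simp: strongly_connected_def)
  then have path: "vpath p G" by (simp add: longest_vpath_def)
  obtain i j where "2 \<le> i" "i < length p" "hd p \<rightarrow> p ! i" "j + 2 < length p" "last p \<rightarrow> p ! j"
    using longest_vpath_end_chords[OF longest deg] .
  then obtain c where cycle: "vcycle c G"
    and length_c: "even (length c) \<or> c = p \<or> 2 * length c \<le> length p + 1"
    by (rule vcycle_if_end_chords[OF path])
  have "length c = card (verts G)" if "c = p"
  proof -
    have "set p = verts G"
      using longest_vpath_vcycle_spanning[OF sconn longest] cycle that by simp
    then show ?thesis using that distinct_card[OF vpathD(2)[OF path]] by simp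
  qed
  moreover have "length p \<le> card (verts G)" using path by (rule length_vpath_le)
  ultimately show thesis using that[OF cycle] length_c by linarith
qed

lemma (in graph) MI_2_le_half_card_verts:
  assumes "Digraph_Component.connected G" "2 \<le> min_degree G" "even (card (verts G))"
  shows "2 * MI 2 G \<le> card (verts G)"
proof -
  obtain c where cycle: "vcycle c G"
    and "even (length c) \<or> length c = card (verts G) \<or> 2 * length c \<le> card (verts G) + 1"
    using ex_even_or_spanning_or_short_vcycle[OF assms(1,2)] .
  then have "even (length c) \<or> 2 * length c \<le> card (verts G)"
    using \<open>even (card (verts G))\<close> by (auto elim!: evenE)
  moreover have "c \<noteq> []" "length c \<le> card (verts G)"
    using cycle length_vpath_le by (auto simp: vcycle_def)
  ultimately have "2 * card (alternate_vertices c) \<le> card (verts G)"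
    using card_alternate_vertices_le[of c] card_alternate_vertices_le_half[of c]
    by linarith
  then show ?thesis using MI_le_card[OF immortal_set_alternate_vertices[OF cycle]] by linarith
qed

theorem theorem8:
  fixes G :: "('a, 'b) pre_digraph" and r n :: nat and x :: real
  assumes "graph G"
    and "Digraph_Component.connected G"
    and "n = card (verts G)"
    and "1 \<le> r" and "r \<le> min_degree G"
    and "x = (if odd n then 0 else 1)"
  shows "(r = 1 \<longrightarrow> MI r G = 1) \<and>
         (r = 2 \<longrightarrow> 2 \<le> MI r G \<and> real (MI r G) \<le> real n / (1 + x)) \<and>
         (3 \<le> r \<longrightarrow> r \<le> MI r G \<and> MI r G \<le> n)"
proof -
  interpret graph G by fact
  obtain v where v_in_verts: "v \<in> verts G"
    using assms(2) by (auto simp: connected_def strongly_connected_def)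
  then have immortal: "immortal_set r G (verts G)"
    using assms(5) by (intro immortal_set_verts) auto
  have lower: "r \<le> MI r G" using immortal by (rule le_MI)
  have upper: "MI r G \<le> n" using MI_le_card[OF immortal] assms(3) by simp
  have "neighbors G v \<noteq> {}" using min_degree_le_card_neighbors[OF v_in_verts] assms(4,5) by auto
  then have "MI 1 G = 1" using MI_1_eq_1 by (auto simp: neighbors_def)
  moreover have "real (MI r G) \<le> real n / (1 + x)" if "r = 2"
    using upper assms that MI_2_le_half_card_verts by (cases "even n") auto
  ultimately show ?thesis using lower upper by auto
qed

end
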